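(* Let $G=(S,T;E)$ with $S=\{s_1,\dots,s_n\}$ and let $d=|T|$. Then the linear program (LP2) is integral.
   Context: $G$ is a finite bipartite graph without loops or parallel edges; the nodes of $S$ are in the fixed order $s_1,\dots,s_n$. $\Delta(v)$ is the set of edges incident to $v$, and $R_d(s_i)=\{s_i,\dots,s_{\min(i+d-1,n)}\}$. (LP2), for a weight function $w:E\to\mathbb R_+$, is: maximize $\sum_{st\in E}w_{st}x_{st}$ subject to $x\in\mathbb R_+^E$, $\sum_{st\in\Delta(s)}x_{st}=1$ for all $s\in S$, and $\sum_{s't\in E:\,s'\in R_d(s)}x_{s't}\le1$ for all $s\in S,t\in T$. Integral means every vertex of its feasible region is an integer vector (equivalently, its optimum, when finite, is attained by an integral solution, which corresponds to a perfect $d$-distance matching). *)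

theory Defs
  imports "HOL-Analysis.Analysis"
begin

(* Edges are pairs (s, t), so the two sides of the bipartition are disjoint by typing
   and there are neither loops nor parallel edges. *)
definition bipartite_graph :: "'s set \<Rightarrow> 't set \<Rightarrow> ('s \<times> 't) set \<Rightarrow> bool" where
  "bipartite_graph S T E \<longleftrightarrow> finite S \<and> finite T \<and> E \<subseteq> S \<times> T"

definition incident_edges :: "('s \<times> 't) set \<Rightarrow> 's \<Rightarrow> ('s \<times> 't) set" where
  "incident_edges E v = {e \<in> E. fst e = v}"

(* The window R_d(s_i) = {s_i, ..., s_min(i+d-1,n)}; indices start at 1, so the natural
   number subtraction is exact. It is empty for d = 0. *)
definition window :: "(nat \<Rightarrow> 's) \<Rightarrow> nat \<Rightarrow> nat \<Rightarrow> nat \<Rightarrow> 's set" where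
  "window s n d i = s ` {i..min (i + d - 1) n}"

record ('e::finite) max_program =
  objective :: "real ^ 'e \<Rightarrow> real"
  feasible_region :: "(real ^ 'e) set"

definition integral_program :: "'e::finite max_program \<Rightarrow> bool" where
  "integral_program P \<longleftrightarrow> 
     (\<forall>v. v extreme_point_of feasible_region P \<longrightarrow> (\<forall>e. v $ e \<in> \<int>))"

(* The space of real vectors indexed by E is represented by the coordinate subspace of
   vectors indexed by all pairs that vanish outside E. *)
definition LP2 ::
  "(nat \<Rightarrow> 's::finite) \<Rightarrow> nat \<Rightarrow> 't::finite set \<Rightarrow> ('s \<times> 't) set \<Rightarrow> nat \<Rightarrow> ('s \<times> 't \<Rightarrow> real)
    \<Rightarrow> ('s \<times> 't) max_program" where
  "LP2 s n T E d w =
     \<lparr> objective = (\<lambda>x. \<Sum>e\<in>E. w e * x $ e),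
       feasible_region =
         {x. (\<forall>e. e \<notin> E \<longrightarrow> x $ e = 0) \<and>
             (\<forall>e\<in>E. 0 \<le> x $ e) \<and>
             (\<forall>i\<in>{1..n}. (\<Sum>e\<in>incident_edges E (s i). x $ e) = 1) \<and>
             (\<forall>i\<in>{1..n}. \<forall>t\<in>T. 
                (\<Sum>e\<in>{e \<in> E. fst e \<in> window s n d i \<and> snd e = t}. x $ e) \<le> 1)} \<rparr>"

end

theory Submission
  imports Defs
begin

text \<open>Since \<open>d = |T|\<close>, every full window constraint is tight, so a feasible \<open>x\<close> is \<open>d\<close>-periodic in
  the index of \<open>S\<close> and is determined by its first \<open>min n d\<close> rows. Together with a row of slacks
  these form a nonnegative matrix with integral row and column sums. If it has a fractional entry,
  then every line through a fractional entry contains another one, so a dimension count yields a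
  nonzero matrix \<open>z\<close> supported on the fractional entries with all line sums zero. The periodic
  extension \<open>p\<close> of a small multiple of \<open>z\<close> exhibits \<open>x\<close> as the midpoint of the feasible points
  \<open>x + p\<close> and \<open>x - p\<close>.\<close>

section \<open>Nonzero matrices with prescribed support and zero line sums\<close>

lemma twice_card_image_le_card:
  assumes "finite F" and "\<And>e. e \<in> F \<Longrightarrow> \<exists>e'\<in>F. e' \<noteq> e \<and> f e' = f e"
  shows "2 * card (f ` F) \<le> card F"
proof -
  have "2 \<le> card {e \<in> F. f e = b}" if "b \<in> f ` F" for b
  proof -
    obtain e where e: "e \<in> F" "f e = b" using \<open>b \<in> f ` F\<close> by blast
    then obtain e' where "e' \<in> F" "e' \<noteq> e" "f e' = b" using assms(2)[of e] by blast
    with e have "{e, e'} \<subseteq> {e \<in> F. f e = b}" "card {e, e'} = 2"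
      by auto
    then show ?thesis
      using card_mono[of "{e \<in> F. f e = b}" "{e, e'}"] assms(1) by simp
  qed
  then have "(\<Sum>b\<in>f ` F. 2) \<le> (\<Sum>b\<in>f ` F. card {e \<in> F. f e = b})"
    by (rule sum_mono)
  also have "\<dots> = card F"
    using sum.image_gen[OF assms(1), of "\<lambda>_. 1::nat" f] by simp
  finally show ?thesis by simp
qed

text \<open>Read as a bipartite graph, \<open>F\<close> has no vertex of degree one, so it contains
  a cycle, and alternating signs along it would do. Counting dimensions avoids constructing the
  cycle: the incidence vectors of the cells in \<open>F\<close> outnumber a set spanning
  them.\<close>

lemma exists_zero_line_sums:
  fixes F :: "('r::finite \<times> 'c::finite) set"
  assumes "F \<noteq> {}"
    and row: "\<And>r c. (r, c) \<in> F \<Longrightarrow> \<exists>c'. c' \<noteq> c \<and> (r, c') \<in> F"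
    and col: "\<And>r c. (r, c) \<in> F \<Longrightarrow> \<exists>r'. r' \<noteq> r \<and> (r', c) \<in> F"
  obtains z :: "'r \<times> 'c \<Rightarrow> real"
  where "\<exists>e. z e \<noteq> 0" and "\<And>e. e \<notin> F \<Longrightarrow> z e = 0"
    and "\<And>r. (\<Sum>c\<in>UNIV. z (r, c)) = 0" and "\<And>c. (\<Sum>r\<in>UNIV. z (r, c)) = 0"
proof -
  \<comment> \<open>The incidence vector of a cell, with \<open>Inl\<close> coordinates for rows and
    \<open>Inr\<close> coordinates for columns. The coordinates of a linear combination of these
    vectors are the line sums of its coefficient matrix.\<close>
  define v :: "'r \<times> 'c \<Rightarrow> real ^ ('r + 'c)"
    where "v e = axis (Inl (fst e)) 1 + axis (Inr (snd e)) 1" for e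
  have vl: "v (r, c) $ Inl r' = (if r' = r then 1 else 0)" for r c r'
    by (auto simp: v_def axis_def)
  have vr: "v (r, c) $ Inr c' = (if c' = c then 1 else 0)" for r c c'
    by (auto simp: v_def axis_def)
  have inj: "inj v"
  proof (rule injI)
    fix e e' assume eq: "v e = v e'"
    obtain r c r' c' where e: "e = (r, c)" "e' = (r', c')" by fastforce
    have "v e $ Inl r = v e' $ Inl r" "v e $ Inr c = v e' $ Inr c" using eq by auto
    then show "e = e'" by (auto simp: e vl vr split: if_splits)
  qed
  obtain r0 c0 where rc0: "(r0, c0) \<in> F" using assms(1) by auto
  define R where "R = fst ` F"
  define C where "C = snd ` F"
  have "2 * card R \<le> card F"
    unfolding R_def using row by (intro twice_card_image_le_card) (simp, fastforce)
  moreover have "2 * card C \<le> card F"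
    unfolding C_def using col by (intro twice_card_image_le_card) (simp, fastforce)
  moreover have c0: "c0 \<in> C" using rc0 by (force simp: C_def)
  moreover have "0 < card C" using c0 by (auto simp: card_gt_0_iff)
  \<comment> \<open>Rows and columns each number at most half of \<open>card F\<close>; dropping
    \<open>c0\<close> makes the inequality strict.\<close>
  ultimately have big: "card R + card (C - {c0}) < card F"
    by simp
  \<comment> \<open>The vectors \<open>v e\<close> satisfy one linear relation: the row coordinates and the column
    coordinates have the same sum. Hence one generator fewer than \<open>card R + card C\<close> suffices.\<close>
  define B where "B = (\<lambda>r. v (r, c0)) ` R \<union>
    (\<lambda>c. axis (Inr c) 1 - axis (Inr c0) 1 :: real ^ ('r + 'c)) ` (C - {c0})"
  have "v e \<in> span B" if "e \<in> F" for e
  proof (cases "snd e = c0")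
    case True
    then have "v e \<in> B" using that by (force simp: B_def R_def)
    then show ?thesis by (rule span_base)
  next
    case False
    have "v e = v (fst e, c0) + (axis (Inr (snd e)) 1 - axis (Inr c0) 1)"
      by (simp add: v_def)
    moreover have "v (fst e, c0) \<in> B" "axis (Inr (snd e)) 1 - axis (Inr c0) 1 \<in> B"
      using that False by (auto simp: B_def R_def C_def)
    ultimately show ?thesis by (metis span_add span_base)
  qed
  then have sub: "v ` F \<subseteq> span B" by auto
  have "card B \<le> card R + card (C - {c0})"
    unfolding B_def by (intro order_trans[OF card_Un_le] add_mono card_image_le) auto
  then have "card B < card (v ` F)"
    using big inj by (simp add: card_image inj_on_subset)
  then have "dependent (v ` F)"
    using independent_span_bound[of B "v ` F"] sub by (auto simp: B_def)
  then obtain u where u: "\<exists>w\<in>v ` F. u w \<noteq> 0" "(\<Sum>w\<in>v ` F. u w *\<^sub>R w) = 0"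
    using dependent_finite[of "v ` F"] by auto
  define z where "z e = (if e \<in> F then u (v e) else 0)" for e
  have "(\<Sum>e\<in>UNIV. z e *\<^sub>R v e) = (\<Sum>e\<in>F. u (v e) *\<^sub>R v e)"
    by (intro sum.mono_neutral_cong_right) (auto simp: z_def)
  also have "\<dots> = 0"
    using u(2) inj by (simp add: sum.reindex inj_on_subset)
  finally have "(\<Sum>e\<in>UNIV. z e *\<^sub>R v e) $ i = 0" for i by simp
  then have "(\<Sum>e\<in>UNIV. z e * v e $ i) = 0" for i by simp
  then have zero: "(\<Sum>r\<in>UNIV. \<Sum>c\<in>UNIV. z (r, c) * v (r, c) $ i) = 0" for i
    by (simp add: sum.cartesian_product)
  have "(\<Sum>c\<in>UNIV. z (r, c)) = 0" for r
  proof -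
    have "0 = (\<Sum>r'\<in>UNIV. \<Sum>c\<in>UNIV. z (r', c) * v (r', c) $ Inl r)"
      using zero by simp
    also have "\<dots> = (\<Sum>r'\<in>UNIV. if r = r' then \<Sum>c\<in>UNIV. z (r', c) else 0)"
      by (intro sum.cong) (auto simp: vl)
    finally show ?thesis by simp
  qed
  moreover have "(\<Sum>r\<in>UNIV. z (r, c)) = 0" for c
  proof -
    have "0 = (\<Sum>r\<in>UNIV. \<Sum>c'\<in>UNIV. z (r, c') * v (r, c') $ Inr c)"
      using zero by simp
    also have "\<dots> = (\<Sum>r\<in>UNIV. \<Sum>c'\<in>UNIV. if c = c' then z (r, c') else 0)"
      by (intro sum.cong) (auto simp: vr)
    finally show ?thesis by simp
  qed
  moreover have "\<exists>e. z e \<noteq> 0" using u(1) by (auto simp: z_def)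
  moreover have "z e = 0" if "e \<notin> F" for e using that by (simp add: z_def)
  ultimately show ?thesis using that by blast
qed

lemma exists_other_nonint_term:
  fixes g :: "'a \<Rightarrow> real"
  assumes "finite A" "a \<in> A" "g a \<notin> \<int>" "sum g A \<in> \<int>"
  shows "\<exists>b\<in>A. b \<noteq> a \<and> g b \<notin> \<int>"
proof (rule ccontr)
  assume "\<not> ?thesis"
  then have "sum g (A - {a}) \<in> \<int>" by (intro Ints_sum) auto
  then have "sum g A - sum g (A - {a}) \<in> \<int>" using assms(4) by (rule Ints_diff[rotated])
  then show False using assms by (simp add: sum_diff1)
qed

text \<open>A nonintegral term of an integral sum is never the only one, so the nonintegral entries
  form a support to which \<open>exists_zero_line_sums\<close> applies. The bound by
  \<open>y\<close> keeps both \<open>y + z\<close> and \<open>y - z\<close> nonnegative.\<close>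

lemma exists_nonint_perturbation:
  fixes y :: "'r::finite \<times> 'c::finite \<Rightarrow> real"
  assumes "\<And>e. 0 \<le> y e" and "y e0 \<notin> \<int>"
    and "\<And>r. (\<Sum>c\<in>UNIV. y (r, c)) \<in> \<int>" and "\<And>c. (\<Sum>r\<in>UNIV. y (r, c)) \<in> \<int>"
  obtains z :: "'r \<times> 'c \<Rightarrow> real"
  where "\<exists>e. z e \<noteq> 0" and "\<And>e. y e \<in> \<int> \<Longrightarrow> z e = 0" and "\<And>e. \<bar>z e\<bar> \<le> y e"
    and "\<And>r. (\<Sum>c\<in>UNIV. z (r, c)) = 0" and "\<And>c. (\<Sum>r\<in>UNIV. z (r, c)) = 0"
proof -
  define F where "F = {e. y e \<notin> \<int>}"
  have "F \<noteq> {}" using assms(2) unfolding F_def by blast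
  moreover have "\<exists>c'. c' \<noteq> c \<and> (r, c') \<in> F" if "(r, c) \<in> F" for r c
    using exists_other_nonint_term[of UNIV c "\<lambda>c. y (r, c)"] assms(3) that
    by (auto simp: F_def)
  moreover have "\<exists>r'. r' \<noteq> r \<and> (r', c) \<in> F" if "(r, c) \<in> F" for r c
    using exists_other_nonint_term[of UNIV r "\<lambda>r. y (r, c)"] assms(4) that
    by (auto simp: F_def)
  ultimately obtain z :: "'r \<times> 'c \<Rightarrow> real"
    where z: "\<exists>e. z e \<noteq> 0" "\<And>e. e \<notin> F \<Longrightarrow> z e = 0"
      "\<And>r. (\<Sum>c\<in>UNIV. z (r, c)) = 0" "\<And>c. (\<Sum>r\<in>UNIV. z (r, c)) = 0"
    using exists_zero_line_sums[of F] by blast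
  have pos: "0 < y e" if "e \<in> F" for e
    using that assms(1)[of e] by (cases "y e = 0") (auto simp: F_def)
  define k where "k = Min (insert 1 ((\<lambda>e. y e / \<bar>z e\<bar>) ` {e. z e \<noteq> 0}))"
  have k: "k \<le> y e / \<bar>z e\<bar>" if "z e \<noteq> 0" for e
    unfolding k_def using that by (intro Min_le) auto
  have "0 < k"
    unfolding k_def using pos z(2) by (subst Min_gr_iff) (auto intro!: divide_pos_pos)
  have le: "\<bar>k * z e\<bar> \<le> y e" for e
  proof (cases "z e = 0")
    case False
    then show ?thesis using k[OF False] \<open>0 < k\<close> by (simp add: abs_mult pos_le_divide_eq)
  qed (use assms(1) in simp)
  show ?thesis
  proof (rule that[of "\<lambda>e. k * z e"])
    show "\<exists>e. k * z e \<noteq> 0" using z(1) \<open>0 < k\<close> by auto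
  qed (use z le in \<open>auto simp: F_def simp flip: sum_distrib_left\<close>)
qed

section \<open>Index form of the constraints and periodicity modulo \<open>d\<close>\<close>

text \<open>Coordinates outside \<open>E\<close> vanish, so sums over edges extend to all pairs, and
  injectivity of \<open>s\<close> turns sums over nodes of a window into sums over indices.\<close>

lemma feasible_LP2_iff:
  fixes s :: "nat \<Rightarrow> 's::finite" and T :: "'t::finite set"
  assumes "bipartite_graph S T E" and "bij_betw s {1..n} S"
  shows "x \<in> feasible_region (LP2 s n T E d w) \<longleftrightarrow>
    (\<forall>e. e \<notin> E \<longrightarrow> x $ e = 0) \<and> (\<forall>e. 0 \<le> x $ e) \<and>
    (\<forall>i\<in>{1..n}. (\<Sum>t\<in>UNIV. x $ (s i, t)) = 1) \<and>
    (\<forall>i\<in>{1..n}. \<forall>t\<in>T. (\<Sum>j\<in>{i..min (i + d - 1) n}. x $ (s j, t)) \<le> 1)"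
proof (cases "\<forall>e. e \<notin> E \<longrightarrow> x $ e = 0")
  case True
  have row: "(\<Sum>e\<in>incident_edges E a. x $ e) = (\<Sum>t\<in>UNIV. x $ (a, t))" for a
  proof -
    have "(\<Sum>t\<in>UNIV. x $ (a, t)) = (\<Sum>e\<in>Pair a ` UNIV. x $ e)"
      by (subst sum.reindex) (auto simp: inj_on_def)
    also have "\<dots> = (\<Sum>e\<in>incident_edges E a. x $ e)"
      using True by (intro sum.mono_neutral_right) (auto simp: incident_edges_def)
    finally show ?thesis by simp
  qed
  have col: "(\<Sum>e\<in>{e \<in> E. fst e \<in> window s n d i \<and> snd e = t}. x $ e) =
      (\<Sum>j\<in>{i..min (i + d - 1) n}. x $ (s j, t))" if "i \<in> {1..n}" for i t
  proof -
    let ?J = "{i..min (i + d - 1) n}"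
    have "inj_on s ?J"
      using assms(2) that by (auto simp: bij_betw_def intro: inj_on_subset)
    then have "(\<Sum>j\<in>?J. x $ (s j, t)) = (\<Sum>e\<in>(\<lambda>j. (s j, t)) ` ?J. x $ e)"
      by (subst sum.reindex) (auto simp: inj_on_def)
    also have "\<dots> = (\<Sum>e\<in>{e \<in> E. fst e \<in> window s n d i \<and> snd e = t}. x $ e)"
      using True by (intro sum.mono_neutral_right) (auto simp: window_def)
    finally show ?thesis by simp
  qed
  have "(\<forall>e\<in>E. 0 \<le> x $ e) \<longleftrightarrow> (\<forall>e. 0 \<le> x $ e)"
    using True by (metis order_refl)
  then show ?thesis
    using True by (simp add: LP2_def row col)
next
  case False
  then show ?thesis by (simp only: LP2_def max_program.simps mem_Collect_eq simp_thms)
qed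

text \<open>The full windows are tight since their \<open>d\<close> rows have total \<open>d = |T|\<close>; comparing two
  consecutive ones gives periodicity.\<close>

lemma periodic_of_window_sums:
  fixes X :: "nat \<Rightarrow> 't::finite \<Rightarrow> real"
  assumes "d = card T" "0 < d"
    and row: "\<And>i. i \<in> {1..n} \<Longrightarrow> (\<Sum>t\<in>T. X i t) = 1"
    and win: "\<And>i t. i \<in> {1..n} \<Longrightarrow> t \<in> T \<Longrightarrow> (\<Sum>j\<in>{i..min (i + d - 1) n}. X j t) \<le> 1"
    and "t \<in> T" "j \<in> {1..n}"
  shows "X j t = X ((j - 1) mod d + 1) t"
proof -
  \<comment> \<open>The condition \<open>i + d \<le> n + 1\<close> says that the window at
    \<open>i\<close> is not cut off at \<open>n\<close>, so it has exactly \<open>d\<close>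
    rows.\<close>
  have tight: "(\<Sum>j\<in>{i..<i + d}. X j t) = 1" if "1 \<le> i" "i + d \<le> n + 1" "t \<in> T" for i t
  proof -
    have J: "{i..min (i + d - 1) n} = {i..<i + d}" using that \<open>0 < d\<close> by auto
    have le: "(\<Sum>j\<in>{i..<i + d}. X j t) \<le> 1" if "t \<in> T" for t
      using win[of i t] J \<open>1 \<le> i\<close> \<open>i + d \<le> n + 1\<close> \<open>0 < d\<close> that by simp
    have "(\<Sum>t\<in>T. \<Sum>j\<in>{i..<i + d}. X j t) = (\<Sum>j\<in>{i..<i + d}. \<Sum>t\<in>T. X j t)"
      by (rule sum.swap)
    also have "\<dots> = (\<Sum>j\<in>{i..<i + d}. 1)"
      using that by (intro sum.cong refl row) auto
    also have "\<dots> = (\<Sum>t\<in>T. 1)" using \<open>d = card T\<close> by simp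
    finally show ?thesis using le \<open>t \<in> T\<close> by (intro sum_mono_inv[of _ T "\<lambda>_. 1"]) auto
  qed
  have step: "X (i + d) t = X i t" if "1 \<le> i" "i + d \<le> n" for i
  proof -
    have "X i t + (\<Sum>j\<in>{Suc i..<i + d}. X j t) = 1"
      using tight[of i t] that \<open>t \<in> T\<close> \<open>0 < d\<close> by (simp add: sum.atLeast_Suc_lessThan)
    moreover have "(\<Sum>j\<in>{Suc i..<i + d}. X j t) + X (i + d) t = 1"
      using tight[of "Suc i" t] that \<open>t \<in> T\<close> \<open>0 < d\<close> by (simp add: sum.atLeastLessThan_Suc)
    ultimately show ?thesis by simp
  qed
  have "X j t = X ((j - 1) mod d + 1) t" if "1 \<le> j" "j \<le> n" for j
    using that
  proof (induction j rule: less_induct)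
    case (less j)
    show ?case
    proof (cases "j \<le> d")
      case True
      then show ?thesis using less.prems by simp
    next
      case False
      then have "X j t = X (j - d) t" using step[of "j - d"] less.prems by simp
      also have "\<dots> = X ((j - d - 1) mod d + 1) t"
        using False less \<open>0 < d\<close> by simp
      also have "(j - d - 1) mod d = (j - 1) mod d"
        using False by (simp add: le_mod_geq mod_if)
      finally show ?thesis .
    qed
  qed
  then show ?thesis using \<open>j \<in> {1..n}\<close> by simp
qed

text \<open>Two of \<open>d\<close> consecutive indices differ by less than \<open>d\<close>. Hence
  a window uses each row of the first period at most once.\<close>

lemma inj_on_mod_window: "inj_on (\<lambda>j. (j - 1) mod d + 1) {i..<i + d}" if "1 \<le> i" for i d :: nat
proof (rule inj_onI)
  fix j j' assume "j \<in> {i..<i + d}" "j' \<in> {i..<i + d}"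
    and eq: "(j - 1) mod d + 1 = (j' - 1) mod d + 1"
  then have "int (j - 1) mod int d = int (j' - 1) mod int d"
    by (metis add_right_cancel of_nat_mod)
  then have "int d dvd int (j - 1) - int (j' - 1)"
    by (simp only: mod_eq_dvd_iff)
  moreover have "\<bar>int (j - 1) - int (j' - 1)\<bar> < int d"
    using \<open>j \<in> _\<close> \<open>j' \<in> _\<close> that by auto
  ultimately have "int (j - 1) - int (j' - 1) = 0"
    using dvd_imp_le_int[of "int (j - 1) - int (j' - 1)" "int d"] by linarith
  moreover have "1 \<le> j" "1 \<le> j'"
    using \<open>j \<in> _\<close> \<open>j' \<in> _\<close> that by auto
  ultimately show "j = j'" by linarith
qed

section \<open>Feasible perturbations of a fractional point in both directions\<close>

theorem theorem5:
  fixes s :: "nat \<Rightarrow> 's::finite" and n d :: nat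
    and S :: "'s set" and T :: "'t::finite set" and E :: "('s \<times> 't) set"
    and w :: "'s \<times> 't \<Rightarrow> real"
  assumes "bipartite_graph S T E"
    and "bij_betw s {1..n} S"
    and "d = card T"
    and "\<forall>e\<in>E. 0 \<le> w e"
  shows "integral_program (LP2 s n T E d w)"
proof -
  let ?P = "feasible_region (LP2 s n T E d w)"
  note feas = feasible_LP2_iff[OF assms(1,2), where d = d and w = w]
  have ET: "E \<subseteq> S \<times> T" using assms(1) by (simp add: bipartite_graph_def)
  have inj: "inj_on s {1..n}" and S: "S = s ` {1..n}"
    using assms(2) by (auto simp: bij_betw_def)
  have False if ext: "x extreme_point_of ?P" and nonint: "x $ e0 \<notin> \<int>" for x e0
  proof -
    from ext have "x \<in> ?P" by (simp add: extreme_point_of_def)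
    then have xE: "\<And>e. e \<notin> E \<Longrightarrow> x $ e = 0" and x0: "\<And>e. 0 \<le> x $ e"
      and xrow: "\<And>i. i \<in> {1..n} \<Longrightarrow> (\<Sum>t\<in>UNIV. x $ (s i, t)) = 1"
      and xwin: "\<And>i t. i \<in> {1..n} \<Longrightarrow> t \<in> T \<Longrightarrow>
        (\<Sum>j\<in>{i..min (i + d - 1) n}. x $ (s j, t)) \<le> 1"
      unfolding feas by blast+
    have xT: "x $ (a, t) = 0" if "t \<notin> T" for a t using xE ET that by auto
    have xrowT: "(\<Sum>t\<in>T. x $ (s i, t)) = 1" if "i \<in> {1..n}" for i
      using xrow[OF that] xT by (subst sum.mono_neutral_left[of UNIV T]) auto
    \<comment> \<open>A nonintegral coordinate lies on an edge, so \<open>T\<close> is nonempty and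
      \<open>d\<close> is positive.\<close>
    have e0: "e0 \<in> S \<times> T" using xE ET nonint by (metis Ints_0 subsetD)
    then have "0 < d" using assms(3) by (auto simp: card_gt_0_iff)
    \<comment> \<open>The first period has \<open>m\<close> rows, and \<open>r j\<close> is the
      index in it congruent to \<open>j\<close> modulo \<open>d\<close>; the shifts by one are due
      to indices starting at \<open>1\<close>.\<close>
    define m where "m = min n d"
    define r where "r j = (j - 1) mod d + 1" for j :: nat
    have r: "r j \<in> {1..m}" if "j \<in> {1..n}" for j
    proof -
      have "r j \<le> d" using \<open>0 < d\<close> by (simp add: r_def Suc_leI)
      moreover have "r j \<le> j" using that mod_less_eq_dividend[of "j - 1" d]
        unfolding r_def atLeastAtMost_iff by linarith
      ultimately show ?thesis using that by (auto simp: m_def r_def)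
    qed
    have r_id: "r j = j" if "j \<in> {1..m}" for j
      using that by (auto simp: r_def m_def)
    have per: "x $ (s j, t) = x $ (s (r j), t)" if "j \<in> {1..n}" for j t
    proof (cases "t \<in> T")
      case True
      show ?thesis
        unfolding r_def
        using periodic_of_window_sums[OF assms(3) \<open>0 < d\<close>, of n "\<lambda>i t. x $ (s i, t)"]
          xrowT xwin True that by blast
    qed (simp add: xT)
    \<comment> \<open>The row \<open>None\<close> holds the slacks of the first window, which makes all line sums integral.\<close>
    define y :: "'s option \<times> 't \<Rightarrow> real" where
      "y e = (case e of (None, t) \<Rightarrow> if t \<in> T then 1 - (\<Sum>j\<in>{1..m}. x $ (s j, t)) else 0
        | (Some a, t) \<Rightarrow> if a \<in> s ` {1..m} then x $ (a, t) else 0)" for e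
    have injm: "inj_on s {1..m}" using inj by (rule inj_on_subset) (auto simp: m_def)
    \<comment> \<open>Kept general in \<open>f\<close>, since it serves for \<open>y\<close>,
      \<open>z\<close> and \<open>y + c * z\<close>.\<close>
    have colsum: "(\<Sum>b\<in>UNIV. f (b, t)) = f (None, t) + (\<Sum>j\<in>{1..m}. f (Some (s j), t))"
      if "\<And>a. a \<notin> s ` {1..m} \<Longrightarrow> f (Some a, t) = 0"
      for f :: "'s option \<times> 't \<Rightarrow> real" and t
    proof -
      have "(\<Sum>b\<in>UNIV. f (b, t)) = f (None, t) + (\<Sum>a\<in>UNIV. f (Some a, t))"
        by (simp add: UNIV_option_conv sum.reindex)
      also have "(\<Sum>a\<in>UNIV. f (Some a, t)) = (\<Sum>a\<in>s ` {1..m}. f (Some a, t))"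
        using that by (intro sum.mono_neutral_right) auto
      also have "\<dots> = (\<Sum>j\<in>{1..m}. f (Some (s j), t))"
        using injm by (simp add: sum.reindex)
      finally show ?thesis .
    qed
    have ycol: "(\<Sum>b\<in>UNIV. y (b, t)) = (if t \<in> T then 1 else 0)" for t
      by (subst colsum) (auto simp: y_def xT)
    have yrow: "(\<Sum>t\<in>UNIV. y (Some a, t)) = (if a \<in> s ` {1..m} then 1 else 0)" for a
      using xrow by (auto simp: y_def m_def)
    \<comment> \<open>The slacks add up to \<open>d - m\<close>: there are \<open>d\<close> columns
      in \<open>T\<close>, and each of the \<open>m\<close> rows has sum \<open>1\<close>.\<close>
    have "(\<Sum>t\<in>UNIV. y (None, t)) = (\<Sum>t\<in>T. 1 - (\<Sum>j\<in>{1..m}. x $ (s j, t)))"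
      by (intro sum.mono_neutral_cong_right) (auto simp: y_def)
    also have "\<dots> = real d - (\<Sum>j\<in>{1..m}. \<Sum>t\<in>T. x $ (s j, t))"
      using assms(3) by (simp add: sum_subtractf sum.swap[of _ T])
    also have "\<dots> = real d - real m"
      using xrowT by (simp add: m_def)
    finally have yNone: "(\<Sum>t\<in>UNIV. y (None, t)) \<in> \<int>" by simp
    have y0: "0 \<le> y e" for e
    proof -
      have "(\<Sum>j\<in>{1..m}. x $ (s j, t)) \<le> 1" if "t \<in> T" for t
        using xwin[of 1 t] that by (cases "n = 0") (auto simp: m_def min.commute)
      then show ?thesis using x0 by (auto simp: y_def split: prod.split option.split)
    qed
    \<comment> \<open>Periodicity moves the nonintegral coordinate into the first period, where
      \<open>y\<close> sees it.\<close>
    obtain i0 t0 where "i0 \<in> {1..n}" "e0 = (s i0, t0)"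
      using e0 S by auto
    then have "y (Some (s (r i0)), t0) \<notin> \<int>"
      using nonint per r by (auto simp: y_def)
    moreover have "(\<Sum>t\<in>UNIV. y (b, t)) \<in> \<int>" for b
      using yNone yrow by (cases b) auto
    moreover have "(\<Sum>b\<in>UNIV. y (b, t)) \<in> \<int>" for t
      by (simp add: ycol)
    ultimately obtain z where z: "\<exists>e. z e \<noteq> 0" "\<And>e. y e \<in> \<int> \<Longrightarrow> z e = 0"
      "\<And>e. \<bar>z e\<bar> \<le> y e" "\<And>b. (\<Sum>t\<in>UNIV. z (b, t)) = 0" "\<And>t. (\<Sum>b\<in>UNIV. z (b, t)) = 0"
      using exists_nonint_perturbation[of y] y0 by blast
    have zy: "z e = 0" if "y e = 0" for e using z(2) that by simp
    have zsupp: "z (Some a, t) = 0" if "a \<notin> s ` {1..m}" for a t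
      using that by (intro zy) (simp add: y_def)
    \<comment> \<open>The rows of \<open>z\<close> other than the slack row, repeated with period
      \<open>d\<close>; \<open>inv_into\<close> recovers the index of a node.\<close>
    define p :: "real ^ ('s \<times> 't)" where
      "p = (\<chi> e. if fst e \<in> S then z (Some (s (r (inv_into {1..n} s (fst e)))), snd e) else 0)"
    have p: "p $ (s j, t) = z (Some (s (r j)), t)" if "j \<in> {1..n}" for j t
      using that inj S by (simp add: p_def)
    have pS: "p $ (a, t) = 0" if "a \<notin> S" for a t using that by (simp add: p_def)
    \<comment> \<open>This yields nonnegativity of \<open>x + p\<close> and \<open>x - p\<close> and
      also their vanishing outside \<open>E\<close>.\<close>
    have pabs: "\<bar>p $ e\<bar> \<le> x $ e" for e
    proof (cases e)
      case (Pair a t)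
      show ?thesis
      proof (cases "a \<in> S")
        case True
        then obtain j where j: "j \<in> {1..n}" "a = s j" using S by auto
        then show ?thesis
          using z(3)[of "(Some (s (r j)), t)"] r[of j] per p by (simp add: Pair y_def)
      qed (simp add: Pair pS x0)
    qed
    have pert: "x + c *\<^sub>R p \<in> ?P" if "\<bar>c\<bar> = 1" for c
    proof -
      have nonneg: "0 \<le> y e + c * z e" for e
        using z(3)[of e] that by (auto simp: abs_if split: if_splits)
      have entry: "(x + c *\<^sub>R p) $ (s j, t) = y (Some (s (r j)), t) + c * z (Some (s (r j)), t)"
        if "j \<in> {1..n}" for j t
        using that r[of j] per p by (simp add: y_def)
      have "(x + c *\<^sub>R p) $ e = 0" if "e \<notin> E" for e
        using pabs[of e] xE[OF that] by simp
      moreover have "0 \<le> (x + c *\<^sub>R p) $ e" for e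
        using pabs[of e] that by (auto simp: abs_if split: if_splits)
      moreover have "(\<Sum>t\<in>UNIV. (x + c *\<^sub>R p) $ (s i, t)) = 1" if "i \<in> {1..n}" for i
        using that r[of i]
        by (simp add: entry yrow z(4) sum.distrib flip: sum_distrib_left del: vector_add_component)
      moreover have "(\<Sum>j\<in>{i..min (i + d - 1) n}. (x + c *\<^sub>R p) $ (s j, t)) \<le> 1"
        if i: "i \<in> {1..n}" and "t \<in> T" for i t
      proof -
        let ?J = "{i..min (i + d - 1) n}"
        let ?f = "\<lambda>j. y (Some (s j), t) + c * z (Some (s j), t)"
        have J: "?J \<subseteq> {i..<i + d}" "?J \<subseteq> {1..n}" using i \<open>0 < d\<close> by auto
        \<comment> \<open>Whether cut off at \<open>n\<close> or not, a window thus contributes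
          distinct terms of one column of \<open>y + c * z\<close>. The missing terms, slack
          included, are nonnegative, and the whole column sums to \<open>1\<close>.\<close>
        have inj_r: "inj_on r ?J"
          using inj_on_mod_window[of i d] i J(1) unfolding r_def by (auto intro: inj_on_subset)
        have "(\<Sum>j\<in>?J. (x + c *\<^sub>R p) $ (s j, t)) = (\<Sum>j\<in>?J. ?f (r j))"
          using J(2) by (intro sum.cong refl entry) blast
        also have "\<dots> = (\<Sum>j\<in>r ` ?J. ?f j)"
          using inj_r by (simp add: sum.reindex)
        also have "\<dots> \<le> (\<Sum>j\<in>{1..m}. ?f j)"
          using r J(2) nonneg by (intro sum_mono2) auto
        also have "\<dots> \<le> (\<Sum>b\<in>UNIV. y (b, t) + c * z (b, t))"
          using nonneg[of "(None, t)"]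
          by (subst colsum[of "\<lambda>e. y e + c * z e"]) (auto simp: zsupp y_def)
        also have "\<dots> = 1"
          using \<open>t \<in> T\<close> by (simp add: sum.distrib ycol z(5) flip: sum_distrib_left)
        finally show ?thesis .
      qed
      ultimately show ?thesis unfolding feas by blast
    qed
    \<comment> \<open>The nonzero entry of \<open>z\<close> cannot be confined to the slack row,
      because every column of \<open>z\<close> sums to zero.\<close>
    have "p \<noteq> 0"
    proof
      assume "p = 0"
      then have "z (Some (s j), t) = 0" if "j \<in> {1..m}" for j t
        using p[of j t] r_id[of j] that by (simp add: m_def)
      then have zSome: "z (Some a, t) = 0" for a t
        using zsupp by (cases "a \<in> s ` {1..m}") auto
      moreover have "z (None, t) = 0" for t
        using z(5)[of t] colsum[of z t] zSome by simp
      ultimately show False using z(1) by (metis option.exhaust surj_pair)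
    qed
    moreover have "x = midpoint (x + p) (x - p)"
      by (simp add: midpoint_def flip: scaleR_2)
    ultimately have "x \<in> open_segment (x + p) (x - p)"
      using midpoint_in_open_segment[of "x + p" "x - p"]
      by (metis add_diff_cancel_left' diff_add_cancel midpoint_eq_endpoint(1) add.right_neutral)
    moreover have "x + p \<in> ?P" "x - p \<in> ?P"
      using pert[of 1] pert[of "-1"] by simp_all
    ultimately show False using ext by (auto simp: extreme_point_of_def)
  qed
  then show ?thesis unfolding integral_program_def by blast
qed

end
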